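(* Let $m>3$ be an integer, and let $n_0(3,m;6)=\left\lceil \frac{2m^2+7m+3}{3}\right\rceil$. 1. If $m\equiv 0,1 \pmod 3$, then a $(3,m;6)$-bipartite biregular cage is the point-block incidence graph of a Steiner triple system $STS(2m+1)$, of order $n_0(3,m;6)$. 2. If $m\equiv 2 \pmod 3$, then the order of a $(3,m;6)$-bipartite biregular cage is $\frac{2m^2+7m+3}{3}+\frac{m+3}{3}$.
   Context: All graphs are finite and simple. For an even integer $g$, a bipartite biregular $(n,m;g)$-graph is a bipartite graph of girth exactly $g$ with a bipartition such that all vertices in one partite set have degree $n$ and all vertices in the other partite set have degree $m$. An $(n,m;g)$-bipartite biregular cage is a bipartite biregular $(n,m;g)$-graph of minimum order (number of vertices) among all such graphs. A Steiner triple system $STS(v)$ is a collection of 3-element subsets (blocks) of a $v$-element set (of points) such that every 2-element subset of points is contained in exactly one block. Its point-block incidence graph is the bipartite graph whose vertices are the points and the blocks, a point being adjacent to a block if and only if it belongs to it. *)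

theory Defs
  imports "Graph_Theory.Graph_Theory" "HOL-Library.Extended_Nat"
begin

text \<open>
  Finite simple graphs are \<^locale>\<open>pair_graph\<close>s: finite, loop-free, symmetric sets of arcs.
  Each edge is stored as two opposite arcs, so the degree of a vertex is its out-degree.
\<close>

text \<open>
  In a symmetric digraph, traversing an edge back and forth is a \<^const>\<open>pre_digraph.cycle\<close>
  of length 2; the bound on the length leaves exactly the cycles of the undirected graph.
  The girth of an acyclic graph is \<open>\<infinity>\<close>.
\<close>
definition girth :: "'a pair_pre_digraph \<Rightarrow> enat" where
  "girth G = (INF p \<in> {p. pre_digraph.cycle (with_proj G) p \<and> 3 \<le> length p}. enat (length p))"

definition bipartite_biregular :: "nat \<Rightarrow> nat \<Rightarrow> nat \<Rightarrow> 'a pair_pre_digraph \<Rightarrow> bool" where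
  "bipartite_biregular n m g G \<longleftrightarrow>
     pair_graph G \<and> girth G = enat g \<and>
     (\<exists>U W. pverts G = U \<union> W \<and> U \<inter> W = {} \<and>
        parcs G \<subseteq> U \<times> W \<union> W \<times> U \<and>
        (\<forall>u \<in> U. out_degree (with_proj G) u = n) \<and>
        (\<forall>w \<in> W. out_degree (with_proj G) w = m))"

text \<open>
  The competing graphs \<open>H\<close> have natural numbers as vertices, independently of the vertex type
  of \<open>G\<close>. Every finite graph is isomorphic to such a graph, so this is minimality
  among all graphs, even when \<^typ>\<open>'a\<close> is a finite type.
\<close>
definition bipartite_biregular_cage :: "nat \<Rightarrow> nat \<Rightarrow> nat \<Rightarrow> 'a pair_pre_digraph \<Rightarrow> bool" where
  "bipartite_biregular_cage n m g G \<longleftrightarrow>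
     bipartite_biregular n m g G \<and>
     (\<forall>H :: nat pair_pre_digraph. bipartite_biregular n m g H \<longrightarrow>
        card (pverts G) \<le> card (pverts H))"

definition steiner_triple_system :: "nat \<Rightarrow> 'p set \<Rightarrow> 'p set set \<Rightarrow> bool" where
  "steiner_triple_system v P B \<longleftrightarrow>
     finite P \<and> card P = v \<and>
     (\<forall>b \<in> B. b \<subseteq> P \<and> card b = 3) \<and>
     (\<forall>e. e \<subseteq> P \<and> card e = 2 \<longrightarrow> (\<exists>!b. b \<in> B \<and> e \<subseteq> b))"

definition incidence_graph :: "'p set \<Rightarrow> 'p set set \<Rightarrow> ('p + 'p set) pair_pre_digraph" where
  "incidence_graph P B =
     \<lparr> pverts = Inl ` P \<union> Inr ` B,
       parcs = {(Inl x, Inr b) | x b. x \<in> P \<and> b \<in> B \<and> x \<in> b} \<union>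
               {(Inr b, Inl x) | x b. x \<in> P \<and> b \<in> B \<and> x \<in> b} \<rparr>"

definition n0_3_6 :: "nat \<Rightarrow> int" where
  "n0_3_6 m = \<lceil>(2 * real m ^ 2 + 7 * real m + 3) / 3\<rceil>"

end

theory Submission
  imports Defs
begin

text \<open>
  The neighbourhoods of the vertices of degree 3 form a configuration of triples: two points lie in
  at most one common triple, since there is no 4-cycle, and every point lies in \<open>m\<close> triples. Hence a
  point is collinear with exactly \<open>2 * m\<close> others, the number \<open>v\<close> of points is at least \<open>2 * m + 1\<close>,
  and equality holds only for Steiner triple systems. Counting flags, \<open>3\<close> divides \<open>m * v\<close>, which
  excludes \<open>v = 2 * m + 1\<close> for \<open>m mod 3 = 2\<close>. The bounds are attained by the Steiner triple systems
  of Bose and Skolem and, for \<open>m mod 3 = 2\<close>, by a Steiner triple system on \<open>2 * m + 3\<close> points with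
  one point and all the triples through it removed.
\<close>

section \<open>Configurations of triples\<close>

text \<open>\<open>linear\<close> expresses the absence of 4-cycles in the incidence graph. The
  empty configuration is allowed for every \<open>m\<close>, which is why later lemmas ask for a
  point or for \<open>P \<noteq> {}\<close>.\<close>

locale triple_configuration =
  fixes m :: nat and P :: "'p set" and B :: "'p set set"
  assumes finite_points: "finite P"
    and block_subset: "b \<in> B \<Longrightarrow> b \<subseteq> P"
    and card_block: "b \<in> B \<Longrightarrow> card b = 3"
    and linear: "\<lbrakk>b \<in> B; c \<in> B; x \<in> b; x \<in> c; y \<in> b; y \<in> c; x \<noteq> y\<rbrakk> \<Longrightarrow> b = c"
    and degree: "p \<in> P \<Longrightarrow> card {b \<in> B. p \<in> b} = m"
begin

lemma finite_blocks: "finite B"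
  using finite_points block_subset by (meson Pow_iff finite_Pow_iff finite_subset subsetI)

lemma finite_block: "b \<in> B \<Longrightarrow> finite b"
  using finite_points block_subset finite_subset by blast

text \<open>By \<open>linear\<close>, two triples through \<open>p\<close> meet in \<open>p\<close>
  alone, so the remaining pairs are disjoint and each triple contributes two new points.\<close>

lemma card_neighbours:
  assumes "p \<in> P"
  shows "card (\<Union>b\<in>{b \<in> B. p \<in> b}. b - {p}) = 2 * m"
proof -
  have "card (\<Union>b\<in>{b \<in> B. p \<in> b}. b - {p}) = (\<Sum>b\<in>{b \<in> B. p \<in> b}. card (b - {p}))"
  proof (intro card_UN_disjoint ballI impI)
    show "(b - {p}) \<inter> (c - {p}) = {}" if "b \<in> {b \<in> B. p \<in> b}" "c \<in> {b \<in> B. p \<in> b}" "b \<noteq> c" for b c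
      using that linear[of b c p] by blast
  qed (use finite_blocks finite_block in auto)
  also have "\<dots> = (\<Sum>b\<in>{b \<in> B. p \<in> b}. 2)"
    using card_block by (intro sum.cong) auto
  finally show ?thesis using degree[OF assms] by simp
qed

lemma neighbours_subset: "(\<Union>b\<in>{b \<in> B. p \<in> b}. b - {p}) \<subseteq> P - {p}"
  using block_subset by blast

lemma card_points_ge:
  assumes "p \<in> P"
  shows "2 * m + 1 \<le> card P"
proof -
  have "2 * m \<le> card (P - {p})"
    unfolding card_neighbours[OF assms, symmetric]
    using neighbours_subset finite_points by (intro card_mono) auto
  moreover have "card P > 0" using assms finite_points card_gt_0_iff by blast
  ultimately show ?thesis using assms by simp
qed

text \<open>Double counting of incident pairs of a point and a triple. It yields both the
  divisibility by 3 and the number of triples.\<close>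

lemma card_flags: "3 * card B = m * card P"
proof -
  have "(\<Sum>p\<in>P. card {b \<in> B. p \<in> b}) = 3 * card B"
    using finite_points finite_blocks
  proof (rule sum_multicount)
    show "\<forall>b\<in>B. card {p \<in> P. p \<in> b} = 3"
    proof
      fix b assume b: "b \<in> B"
      then have "{p \<in> P. p \<in> b} = b" using block_subset by blast
      then show "card {p \<in> P. p \<in> b} = 3" using card_block b by simp
    qed
  qed
  then show ?thesis using degree by (simp add: mult.commute)
qed

text \<open>This is the equality case of \<open>card_points_ge\<close>: the \<open>2 * m\<close>
  points collinear with \<open>x\<close> exhaust \<open>P - {x}\<close>, so every pair is covered,
  and \<open>linear\<close> gives uniqueness.\<close>

lemma steiner_triple_system:
  assumes "card P = 2 * m + 1"
  shows "steiner_triple_system (2 * m + 1) P B"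
  unfolding steiner_triple_system_def
proof (intro conjI ballI allI impI)
  fix e assume "e \<subseteq> P \<and> card e = 2"
  then obtain x y where e: "e = {x, y}" "x \<noteq> y" "x \<in> P" "y \<in> P"
    by (auto simp: card_2_iff)
  have "(\<Union>b\<in>{b \<in> B. x \<in> b}. b - {x}) = P - {x}"
    using neighbours_subset finite_points e assms card_neighbours[of x] by (intro card_subset_eq) auto
  then obtain b where b: "b \<in> B" "x \<in> b" "y \<in> b" using e by blast
  show "\<exists>!b. b \<in> B \<and> e \<subseteq> b"
  proof (intro ex1I)
    show "b \<in> B \<and> e \<subseteq> b" using b e by simp
    show "c = b" if "c \<in> B \<and> e \<subseteq> c" for c
      using linear[of c b x y] that b e by simp
  qed
qed (use finite_points block_subset card_block assms in auto)

text \<open>At most one other point fails to be collinear with a given point \<open>x\<close>, so \<open>x\<close> is collinear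
  with one of any two points \<open>y\<close>, \<open>z\<close>.\<close>

lemma triangle:
  assumes "P \<noteq> {}" "2 \<le> m" "card P \<le> 2 * m + 2"
  obtains x y z b c d where "b \<in> B" "c \<in> B" "d \<in> B" "x \<in> b" "y \<in> b" "y \<in> c" "z \<in> c" "z \<in> d" "x \<in> d"
    "x \<noteq> y" "y \<noteq> z" "x \<noteq> z" "b \<noteq> c" "c \<noteq> d" "b \<noteq> d"
proof -
  obtain p where p: "p \<in> P" using assms by blast
  have "2 \<le> card {b \<in> B. p \<in> b}" using degree[OF p] assms by simp
  then obtain T where "T \<subseteq> {b \<in> B. p \<in> b}" "card T = 2" by (meson obtain_subset_with_card_n)
  then obtain b d where bd: "b \<in> B" "p \<in> b" "d \<in> B" "p \<in> d" "b \<noteq> d" by (auto simp: card_2_iff)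
  have "card (b - {p}) = 2" "card (d - {p}) = 2" using bd card_block by auto
  \<comment> \<open>The triangle has corners \<open>p\<close>, \<open>x\<close> and
    \<open>w\<close>: \<open>x\<close> lies on \<open>b\<close>, and \<open>w\<close> will be
    whichever of the two points \<open>y\<close>, \<open>z\<close> of \<open>d\<close> is collinear
    with \<open>x\<close>.\<close>
  then obtain x x' y z where "b - {p} = {x, x'}" "d - {p} = {y, z}" and yz: "y \<noteq> z"
    unfolding card_2_iff by blast
  then have xyz: "x \<in> b" "x \<noteq> p" "y \<in> d" "y \<noteq> p" "z \<in> d" "z \<noteq> p" "y \<noteq> z" by blast+
  have x: "x \<notin> d" using xyz bd linear[of b d p x] by metis
  have P: "x \<in> P" "y \<in> P" "z \<in> P" using xyz bd block_subset by auto
  let ?N = "\<Union>b\<in>{b \<in> B. x \<in> b}. b - {x}"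
  have "y \<in> ?N \<or> z \<in> ?N"
  proof (rule ccontr)
    assume "\<not> (y \<in> ?N \<or> z \<in> ?N)"
    then have "?N \<subseteq> P - {x, y, z}" using neighbours_subset[of x] by auto
    then have "card ?N \<le> card (P - {x, y, z})" using finite_points by (intro card_mono) auto
    also have "\<dots> = card P - card {x, y, z}" using P by (intro card_Diff_subset) auto
    also have "card {x, y, z} = 3" using x xyz by (auto simp: card_insert_if)
    finally have "2 * m \<le> card P - 3" using card_neighbours P by simp
    then show False using assms by simp
  qed
  then obtain w c where w: "c \<in> B" "x \<in> c" "w \<in> c" "w \<noteq> x" "w = y \<or> w = z" by blast
  then have wd: "w \<in> d" "w \<noteq> p" using xyz by auto
  \<comment> \<open>The point \<open>w\<close> separates \<open>c\<close> from \<open>b\<close>,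
    just as \<open>x\<close> separates \<open>c\<close> from \<open>d\<close>.\<close>
  have "w \<notin> b" using linear[of b d p w] bd wd by metis
  then show thesis
    using that[of b c d p x w] w wd x bd xyz by metis
qed

end

section \<open>Steiner triple systems as configurations, point removal, and a covering
  criterion\<close>

lemma steiner_triple_system_pairD:
  assumes "steiner_triple_system v P B" "x \<in> P" "y \<in> P" "x \<noteq> y"
  shows "\<exists>!b. b \<in> B \<and> x \<in> b \<and> y \<in> b"
proof -
  have "{x, y} \<subseteq> P \<and> card {x, y} = 2" using assms by simp
  then have "\<exists>!b. b \<in> B \<and> {x, y} \<subseteq> b" using assms unfolding steiner_triple_system_def by metis
  then show ?thesis by simp
qed

text \<open>Each other point shares exactly one triple with \<open>p\<close>, so the triples through
  \<open>p\<close> split the \<open>2 * m\<close> other points into pairs.\<close>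

lemma steiner_triple_system_configuration:
  assumes S: "steiner_triple_system (2 * m + 1) P B"
  shows "triple_configuration m P B"
proof
  show "finite P" using S by (simp add: steiner_triple_system_def)
  show sub: "b \<subseteq> P" and c3: "card b = 3" if "b \<in> B" for b
    using S that by (auto simp: steiner_triple_system_def)
  show lin: "b = c"
    if "b \<in> B" "c \<in> B" "x \<in> b" "x \<in> c" "y \<in> b" "y \<in> c" "x \<noteq> y" for b c x y
  proof -
    have "x \<in> P" "y \<in> P" using that sub by auto
    then show ?thesis using steiner_triple_system_pairD[OF S, of x y] that by metis
  qed
  fix p assume p: "p \<in> P"
  let ?R = "{b \<in> B. p \<in> b}"
  have fB: "finite B"
    using \<open>finite P\<close> sub by (meson Pow_iff finite_Pow_iff finite_subset subsetI)
  have "(\<Union>b\<in>?R. b - {p}) = P - {p}"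
  proof
    show "P - {p} \<subseteq> (\<Union>b\<in>?R. b - {p})"
    proof
      fix y assume y: "y \<in> P - {p}"
      then obtain b where "b \<in> B" "p \<in> b" "y \<in> b"
        using steiner_triple_system_pairD[OF S p, of y] by blast
      then show "y \<in> (\<Union>b\<in>?R. b - {p})" using y by blast
    qed
  qed (use sub in blast)
  then have "2 * m = card (\<Union>b\<in>?R. b - {p})"
    using p S by (simp add: steiner_triple_system_def)
  also have "\<dots> = (\<Sum>b\<in>?R. card (b - {p}))"
  proof (intro card_UN_disjoint ballI impI)
    show "finite (b - {p})" if "b \<in> ?R" for b
      using that sub \<open>finite P\<close> by (auto intro: finite_subset)
    show "(b - {p}) \<inter> (c - {p}) = {}" if "b \<in> ?R" "c \<in> ?R" "b \<noteq> c" for b c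
      using that lin[of b c p] by blast
  qed (use fB in simp)
  also have "\<dots> = (\<Sum>b\<in>?R. 2)"
    using c3 by (intro sum.cong) auto
  finally show "card ?R = m" by simp
qed

text \<open>Exactly one triple joins \<open>p\<close> to \<open>q\<close>, so the removal lowers the
  degree of every remaining point by one, from \<open>Suc m\<close> to \<open>m\<close>.\<close>

lemma steiner_triple_system_punctured:
  assumes S: "steiner_triple_system (2 * m + 3) P B" and q: "q \<in> P"
  shows "triple_configuration m (P - {q}) {b \<in> B. q \<notin> b}"
proof -
  have S': "steiner_triple_system (2 * Suc m + 1) P B" using S by (simp add: numeral_3_eq_3)
  interpret triple_configuration "Suc m" P B
    by (rule steiner_triple_system_configuration[OF S'])
  show ?thesis
  proof
    fix p assume p: "p \<in> P - {q}"
    obtain c where c: "c \<in> B" "p \<in> c" "q \<in> c"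
      using steiner_triple_system_pairD[OF S, of p q] p q by blast
    have "q \<notin> b" if "b \<in> B" "p \<in> b" "b \<noteq> c" for b
      using linear[of b c p q] that c p by blast
    then have "{b \<in> {b \<in> B. q \<notin> b}. p \<in> b} = {b \<in> B. p \<in> b} - {c}"
      using c by blast
    then show "card {b \<in> {b \<in> B. q \<notin> b}. p \<in> b} = m"
      using degree[of p] p c by simp
  next
    show "b = c" if "b \<in> {b \<in> B. q \<notin> b}" "c \<in> {b \<in> B. q \<notin> b}" "x \<in> b" "x \<in> c" "y \<in> b" "y \<in> c" "x \<noteq> y"
      for b c x y
      using linear[of b c x y] that by blast
  qed (use finite_points block_subset card_block in auto)
qed

text \<open>Serves to move configurations from other point types to natural numbers.\<close>

lemma triple_configuration_image:
  assumes "triple_configuration m P B" and f: "inj_on f P"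
  shows "triple_configuration m (f ` P) ((`) f ` B)"
proof -
  interpret triple_configuration m P B by fact
  have mem: "f x \<in> f ` b \<longleftrightarrow> x \<in> b" if "x \<in> P" "b \<in> B" for x b
    using that f block_subset by (meson inj_on_image_mem_iff)
  show ?thesis
  proof
    show "card b = 3" if "b \<in> (`) f ` B" for b
      using that card_block block_subset f by (auto simp: card_image inj_on_subset)
    show "b = c" if bc: "b \<in> (`) f ` B" "c \<in> (`) f ` B"
      and xy: "x \<in> b" "x \<in> c" "y \<in> b" "y \<in> c" "x \<noteq> y" for b c x y
    proof -
      obtain b' c' where bc': "b = f ` b'" "c = f ` c'" "b' \<in> B" "c' \<in> B" using bc by blast
      obtain x' y' where xy': "x = f x'" "y = f y'" "x' \<in> b'" "y' \<in> b'" using xy bc' by blast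
      then have "x' \<in> P" "y' \<in> P" using bc' block_subset by auto
      then have "x' \<in> c'" "y' \<in> c'" using xy bc' xy' mem by auto
      then show ?thesis using linear[of b' c' x' y'] xy bc' xy' by metis
    qed
    fix p assume "p \<in> f ` P"
    then obtain q where q: "q \<in> P" "p = f q" by blast
    have "{b \<in> (`) f ` B. p \<in> b} = (`) f ` {b \<in> B. q \<in> b}" using q mem by auto
    moreover have "inj_on ((`) f) {b \<in> B. q \<in> b}"
      using f block_subset by (intro inj_onI) (metis (no_types, lifting) inj_on_image_eq_iff mem_Collect_eq)
    ultimately show "card {b \<in> (`) f ` B. p \<in> b} = m"
      using degree q by (simp add: card_image)
  qed (use finite_points block_subset in auto)
qed

text \<open>Each triple covers three pairs, so \<open>count\<close> allows at most as many coverings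
  as there are pairs. If every pair is covered, none can be covered twice. The constructions below
  therefore reduce to a covering argument and an upper bound on the number of triples.\<close>

lemma steiner_triple_systemI_cover:
  assumes "finite P" "card P = v"
    and blocks: "\<And>b. b \<in> B \<Longrightarrow> b \<subseteq> P \<and> card b = 3"
    and cover: "\<And>x y. \<lbrakk>x \<in> P; y \<in> P; x \<noteq> y\<rbrakk> \<Longrightarrow> \<exists>b\<in>B. x \<in> b \<and> y \<in> b"
    and count: "6 * card B \<le> v * (v - 1)"
  shows "steiner_triple_system v P B"
proof -
  let ?E = "{e. e \<subseteq> P \<and> card e = 2}"
  let ?B = "\<lambda>e. {b \<in> B. e \<subseteq> b}"
  have fB: "finite B"
    using \<open>finite P\<close> blocks by (meson Pow_iff finite_Pow_iff finite_subset subsetI)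
  have fE: "finite ?E" using \<open>finite P\<close> by simp
  have pos: "1 \<le> card (?B e)" if e: "e \<in> ?E" for e
  proof -
    obtain x y where "e = {x, y}" "x \<noteq> y" "x \<in> P" "y \<in> P" using e by (auto simp: card_2_iff)
    then have "?B e \<noteq> {}" using cover[of x y] by auto
    then show ?thesis using fB by (simp add: Suc_le_eq card_gt_0_iff)
  qed
  \<comment> \<open>Double counting of pairs contained in triples.\<close>
  have "(\<Sum>e\<in>?E. card (?B e)) = 3 * card B"
    using fE fB
  proof (rule sum_multicount)
    show "\<forall>b\<in>B. card {e \<in> ?E. e \<subseteq> b} = 3"
    proof
      fix b assume b: "b \<in> B"
      then have "{e \<in> ?E. e \<subseteq> b} = {e. e \<subseteq> b \<and> card e = 2}" using blocks by blast
      moreover have "finite b" using b blocks by (metis card.infinite zero_neq_numeral)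
      ultimately show "card {e \<in> ?E. e \<subseteq> b} = 3"
        using n_subsets[of b 2] blocks[OF b] by (simp add: choose_two)
    qed
  qed
  moreover have "card ?E = v * (v - 1) div 2"
    using n_subsets[OF \<open>finite P\<close>, of 2] \<open>card P = v\<close> by (simp add: choose_two)
  ultimately have le: "(\<Sum>e\<in>?E. card (?B e)) \<le> (\<Sum>e\<in>?E. 1)" using count by simp
  have one: "card (?B e) = 1" if "e \<in> ?E" for e
  proof (rule ccontr)
    assume "card (?B e) \<noteq> 1"
    then have "(\<Sum>e\<in>?E. 1) < (\<Sum>e\<in>?E. card (?B e))"
      using fE pos that by (intro sum_strict_mono_ex1) (auto simp: le_neq_implies_less)
    then show False using le by simp
  qed
  have "\<exists>!b. b \<in> B \<and> e \<subseteq> b" if e: "e \<subseteq> P \<and> card e = 2" for e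
  proof -
    obtain b where "?B e = {b}" using one[of e] e by (auto simp: card_1_singleton_iff)
    then show ?thesis by (metis (mono_tags, lifting) mem_Collect_eq singleton_iff)
  qed
  then show ?thesis using assms by (simp add: steiner_triple_system_def)
qed

section \<open>Existence of Steiner triple systems\<close>

text \<open>Points are pairs of an element and a level modulo 3. A mixed triple joins two points of
  one level to their product on the next. Indexing by \<open>x < y\<close> takes each unordered pair
  once, which keeps the cardinality bound sharp enough for the covering criterion.\<close>

definition mixed_triples :: "nat \<Rightarrow> (nat \<Rightarrow> nat \<Rightarrow> nat) \<Rightarrow> (nat \<times> nat) set set" where
  "mixed_triples k f =
     (\<lambda>((y, x), i). {(x, i), (y, i), (f x y, (i + 1) mod 3)}) ` ((SIGMA y:{..<k}. {..<y}) \<times> {..<3})"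

lemma card_mixed_triples: "2 * card (mixed_triples k f) \<le> 3 * (k * (k - 1))"
proof -
  have sum: "2 * (\<Sum>y<k. y) = k * (k - 1)" by (induction k) (auto simp: algebra_simps)
  have "card (mixed_triples k f) \<le> card ((SIGMA y:{..<k}. {..<y}) \<times> {..<3::nat})"
    unfolding mixed_triples_def by (intro card_image_le) auto
  also have "\<dots> = 3 * (\<Sum>y<k. y)" by (simp add: card_cartesian_product)
  finally show ?thesis using sum by simp
qed

text \<open>On the finite set \<open>{..<k}\<close>, \<open>closed\<close> and the surjectivity in
  \<open>solve\<close> make every row a permutation; with \<open>commute\<close>, the table is a
  symmetric Latin square.\<close>

locale commutative_quasigroup =
  fixes k :: nat and f :: "nat \<Rightarrow> nat \<Rightarrow> nat"
  assumes closed: "\<lbrakk>x < k; y < k\<rbrakk> \<Longrightarrow> f x y < k"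
    and commute: "f x y = f y x"
    and solve: "\<lbrakk>x < k; y < k\<rbrakk> \<Longrightarrow> \<exists>z<k. f x z = y"
begin

lemma mixed_triplesD:
  assumes "b \<in> mixed_triples k f"
  shows "b \<subseteq> {..<k} \<times> {..<3}" "card b = 3"
proof -
  obtain x y i where b: "b = {(x, i), (y, i), (f x y, (i + 1) mod 3)}" "x < y" "y < k" "i < 3"
    using assms by (auto simp: mixed_triples_def)
  show "b \<subseteq> {..<k} \<times> {..<3}" using b closed[of x y] by auto
  have "(i + 1) mod 3 \<noteq> i" using b(4) by presburger
  then show "card b = 3" using b by (simp add: card_insert_if)
qed

text \<open>The definition provides this for \<open>x < y\<close>; commutativity gives the other
  order.\<close>

lemma mixed_triple_same_level:
  assumes "x < k" "y < k" "x \<noteq> y" "i < 3"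
  shows "{(x, i), (y, i), (f x y, (i + 1) mod 3)} \<in> mixed_triples k f"
proof -
  have ordered: "{(x, i), (y, i), (f x y, (i + 1) mod 3)} \<in> mixed_triples k f"
    if "x < y" "y < k" for x y
    unfolding mixed_triples_def using that \<open>i < 3\<close>
    by (intro image_eqI[where x = "((y, x), i)"]) auto
  show ?thesis
  proof (cases "x < y")
    case False
    then show ?thesis using ordered[of y x] assms by (simp add: commute insert_commute)
  qed (use ordered assms in simp)
qed

text \<open>The third point comes from solving \<open>f x z = y\<close>; the assumption
  \<open>y \<noteq> f x x\<close> ensures that \<open>z\<close> differs from
  \<open>x\<close>.\<close>

lemma mixed_triple_next_level:
  assumes "x < k" "y < k" "i < 3" "y \<noteq> f x x"
  shows "\<exists>b\<in>mixed_triples k f. (x, i) \<in> b \<and> (y, (i + 1) mod 3) \<in> b"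
proof -
  obtain z where z: "z < k" "f x z = y" using solve assms by blast
  then have "x \<noteq> z" using assms by blast
  then show ?thesis using mixed_triple_same_level[of x z i] assms z by auto
qed

text \<open>It remains to cover the pairs \<open>(x, i), (f x x, i + 1)\<close>.\<close>

lemma mixed_triples_cover:
  assumes "x < k" "y < k" "i < 3" "j < 3" "(x, i) \<noteq> (y, j)"
    and diag: "\<And>x i. \<lbrakk>x < k; i < 3\<rbrakk> \<Longrightarrow> \<exists>b\<in>D. (x, i) \<in> b \<and> (f x x, (i + 1) mod 3) \<in> b"
  shows "\<exists>b\<in>mixed_triples k f \<union> D. (x, i) \<in> b \<and> (y, j) \<in> b"
proof -
  have up: "\<exists>b\<in>mixed_triples k f \<union> D. (x, i) \<in> b \<and> (y, (i + 1) mod 3) \<in> b"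
    if "x < k" "y < k" "i < 3" for x y i
    using mixed_triple_next_level[of x y i] diag[of x i] that by (cases "y = f x x") blast+
  have "i = 0 \<or> i = 1 \<or> i = 2" "j = 0 \<or> j = 1 \<or> j = 2" using \<open>i < 3\<close> \<open>j < 3\<close> by auto
  \<comment> \<open>Distinct levels modulo 3 are consecutive in one of the two orders, so
    \<open>up\<close> applies to the pair or to its reversal.\<close>
  then have "i = j \<or> j = (i + 1) mod 3 \<or> i = (j + 1) mod 3" by (elim disjE) simp_all
  then consider "i = j" | "j = (i + 1) mod 3" | "i = (j + 1) mod 3" by blast
  then show ?thesis
  proof cases
    case 1
    then show ?thesis using mixed_triple_same_level[of x y i] assms by blast
  next
    case 2
    then show ?thesis using up assms by blast
  next
    case 3
    then show ?thesis using up[of y x j] assms by blast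
  qed
qed

end

text \<open>Bose's construction: multiplication by \<open>n + 1\<close> is halving modulo \<open>2 * n + 1\<close>, so the
  quasigroup is idempotent.\<close>

lemma bose:
  fixes n :: nat
  shows "\<exists>(P :: (nat \<times> nat) set) B. steiner_triple_system (6 * n + 3) P B"
proof -
  define k where "k = 2 * n + 1"
  define f where "f x y = ((n + 1) * (x + y)) mod k" for x y :: nat
  \<comment> \<open>The three copies of \<open>x\<close> form a triple. By idempotence these triples
    cover the diagonal pairs that the mixed triples miss.\<close>
  define C where "C = (\<lambda>x. {(x, 0 :: nat), (x, 1), (x, 2)}) ` {..<k :: nat}"
  have k: "k > 0" by (simp add: k_def)
  have half: "((n + 1) * (2 * y)) mod k = y" if "y < k" for y
  proof -
    have "(n + 1) * (2 * y) = y + y * k" by (simp add: k_def algebra_simps)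
    then show ?thesis using that by (metis mod_less mod_mult_self1)
  qed
  have idem: "f x x = x" if "x < k" for x
    using half[OF that] by (simp add: f_def mult_2)
  interpret commutative_quasigroup k f
  proof
    show "f x y < k" for x y using k by (simp add: f_def)
    show "f x y = f y x" for x y by (simp add: f_def add.commute)
    fix x y assume xy: "x < k" "y < k"
    \<comment> \<open>Since \<open>f\<close> halves the sum modulo \<open>k\<close>, the solution is
      \<open>2 * y - x\<close>; adding \<open>k\<close> first avoids truncated subtraction.\<close>
    have "f x ((2 * y + (k - x)) mod k) = ((n + 1) * (x + (2 * y + (k - x)))) mod k"
      unfolding f_def by (metis mod_add_right_eq mod_mult_right_eq)
    also have "(n + 1) * (x + (2 * y + (k - x))) = (n + 1) * (2 * y) + (n + 1) * k"
      using xy by (simp add: distrib_left[symmetric])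
    also have "\<dots> mod k = y" using half[OF xy(2)] by (metis mod_mult_self3 add.commute)
    finally show "\<exists>z<k. f x z = y" using k by (meson mod_less_divisor)
  qed
  have "steiner_triple_system (6 * n + 3) ({..<k} \<times> {..<3}) (mixed_triples k f \<union> C)"
  proof (rule steiner_triple_systemI_cover)
    show "finite ({..<k} \<times> {..<3 :: nat})" by simp
    show "card ({..<k} \<times> {..<3 :: nat}) = 6 * n + 3" by (simp add: k_def)
    show "b \<subseteq> {..<k} \<times> {..<3} \<and> card b = 3" if "b \<in> mixed_triples k f \<union> C" for b
      using that mixed_triplesD by (auto simp: C_def)
    fix p q :: "nat \<times> nat" assume "p \<in> {..<k} \<times> {..<3}" "q \<in> {..<k} \<times> {..<3}" "p \<noteq> q"
    moreover have "\<exists>b\<in>C. (x, i) \<in> b \<and> (f x x, (i + 1) mod 3) \<in> b" if "x < k" "i < 3" for x i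
    proof -
      have "i = 0 \<or> i = 1 \<or> i = 2" "{(x, 0), (x, 1), (x, 2)} \<in> C" using that by (auto simp: C_def)
      then show ?thesis using idem[OF that(1)]
        by (intro bexI[of _ "{(x, 0), (x, 1), (x, 2)}"]) auto
    qed
    ultimately show "\<exists>b\<in>mixed_triples k f \<union> C. p \<in> b \<and> q \<in> b"
      using mixed_triples_cover[of "fst p" "fst q" "snd p" "snd q" C] by auto
  next
    have "card C \<le> k" using card_image_le[of "{..<k}"] by (simp add: C_def)
    then have "card (mixed_triples k f \<union> C) \<le> card (mixed_triples k f) + k"
      using card_Un_le[of "mixed_triples k f" C] by linarith
    then have "6 * card (mixed_triples k f \<union> C) \<le> 9 * (k * (k - 1)) + 6 * k"
      using card_mixed_triples[of k f] by linarith
    also have "\<dots> = (6 * n + 3) * (6 * n + 3 - 1)" by (simp add: k_def algebra_simps)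
    finally show "6 * card (mixed_triples k f \<union> C) \<le> (6 * n + 3) * (6 * n + 3 - 1)" .
  qed
  then show ?thesis by blast
qed

text \<open>Skolem's construction: a half-idempotent commutative quasigroup on \<open>{..<2 * n}\<close> and an
  additional point, encoded as \<open>(2 * n, 0)\<close>.\<close>

lemma skolem:
  fixes n :: nat
  shows "\<exists>(P :: (nat \<times> nat) set) B. steiner_triple_system (6 * n + 1) P B"
proof -
  define k where "k = 2 * n"
  \<comment> \<open>\<open>h\<close> permutes \<open>{..<2 * n}\<close>: even numbers are halved
    into the lower half, odd ones go to the upper half. Thus \<open>f\<close> is addition modulo
    \<open>k\<close> relabelled so that \<open>x\<close> and \<open>n + x\<close> both have square
    \<open>x\<close> for \<open>x < n\<close>.\<close>
  define h where "h s = (if even s then s div 2 else n + s div 2)" for s :: nat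
  define f where "f x y = h ((x + y) mod k)" for x y :: nat
  \<comment> \<open>The first family covers the diagonal pairs for \<open>x < n\<close>, where
    \<open>f\<close> is idempotent. The second covers those for \<open>n + x\<close> and also every
    pair containing the additional point.\<close>
  define C where "C = (\<lambda>x. {(x, 0), (x, 1), (x, 2)}) ` {..<n :: nat} \<union>
    (\<lambda>(x, i). {(k, 0), (n + x, i), (x, (i + 1) mod 3)}) ` ({..<n} \<times> {..<3 :: nat})"
  have lo: "f x x = x" if "x < n" for x
  proof -
    have "(x + x) mod k = 2 * x" using that by (simp add: k_def mult_2)
    then show ?thesis by (simp add: f_def h_def)
  qed
  have hi: "f (n + x) (n + x) = x" if "x < n" for x
  proof -
    have "n + x + (n + x) = 2 * x + k" by (simp add: k_def)
    then have "(n + x + (n + x)) mod k = 2 * x mod k" by (metis mod_add_self2)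
    also have "\<dots> = 2 * x" using that by (simp add: k_def)
    finally have "(n + x + (n + x)) mod k = 2 * x" .
    then show ?thesis by (simp add: f_def h_def)
  qed
  interpret commutative_quasigroup k f
  proof
    show "f x y < k" if "x < k" "y < k" for x y
    proof -
      have "(x + y) mod k < 2 * n" using that by (simp add: k_def)
      then show ?thesis by (auto simp: f_def h_def k_def)
    qed
    show "f x y = f y x" for x y by (simp add: f_def add.commute)
    fix x y assume xy: "x < k" "y < k"
    \<comment> \<open>The preimage of \<open>y\<close> under \<open>h\<close>; it remains to solve
      an addition modulo \<open>k\<close>.\<close>
    define s where "s = (if y < n then 2 * y else 2 * (y - n) + 1)"
    have s: "s < k" "h s = y" using xy by (auto simp: s_def h_def k_def)
    have "(x + (s + (k - x)) mod k) mod k = (x + (s + (k - x))) mod k" by (simp add: mod_add_right_eq)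
    also have "x + (s + (k - x)) = s + k" using xy by simp
    also have "(s + k) mod k = s" using s by simp
    finally have "f x ((s + (k - x)) mod k) = y" using s by (simp add: f_def)
    then show "\<exists>z<k. f x z = y" using xy(1) by (intro exI[of _ "(s + (k - x)) mod k"]) auto
  qed
  let ?P = "insert (k, 0) ({..<k} \<times> {..<3 :: nat})" and ?B = "mixed_triples k f \<union> C"
  have column: "{(x, 0), (x, 1), (x, 2)} \<in> C" if "x < n" for x
    using that by (auto simp: C_def)
  have infinite: "{(k, 0), (n + x, i), (x, (i + 1) mod 3)} \<in> C" if "x < n" "i < 3" for x i
    using that unfolding C_def by (intro UnI2 image_eqI[where x = "(x, i)"]) auto
  have inf_cover: "\<exists>b\<in>?B. (k, 0) \<in> b \<and> (x, i) \<in> b" if x: "x < k" and "i < 3" for x i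
  proof (cases "x < n")
    case True
    \<comment> \<open>\<open>(i + 2) mod 3\<close> is the level preceding \<open>i\<close>, from
      which a triple of the second family reaches \<open>(x, i)\<close>.\<close>
    have i: "((i + 2) mod 3 + 1) mod 3 = i" using \<open>i < 3\<close> by presburger
    have "{(k, 0), (n + x, (i + 2) mod 3), (x, i)} \<in> C"
      using infinite[of x "(i + 2) mod 3", unfolded i] True by simp
    then show ?thesis by blast
  next
    case False
    then obtain x' where "x = n + x'" "x' < n" using x by (auto simp: k_def le_iff_add not_less)
    then show ?thesis using infinite[of x' i] \<open>i < 3\<close> by blast
  qed
  have diag: "\<exists>b\<in>C. (x, i) \<in> b \<and> (f x x, (i + 1) mod 3) \<in> b" if x: "x < k" and "i < 3" for x i
  proof (cases "x < n")
    case True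
    have "i = 0 \<or> i = 1 \<or> i = 2" using \<open>i < 3\<close> by auto
    then show ?thesis using column[OF True] lo[OF True]
      by (intro bexI[of _ "{(x, 0), (x, 1), (x, 2)}"]) auto
  next
    case False
    then obtain x' where "x = n + x'" "x' < n" using x by (auto simp: k_def le_iff_add not_less)
    then have "f x x = x'" using hi by simp
    then show ?thesis using infinite[OF \<open>x' < n\<close> \<open>i < 3\<close>] \<open>x = n + x'\<close> by (intro bexI) simp_all
  qed
  have "steiner_triple_system (6 * n + 1) ?P ?B"
  proof (rule steiner_triple_systemI_cover)
    show "finite ?P" by simp
    show "card ?P = 6 * n + 1" by (simp add: k_def)
    show "b \<subseteq> ?P \<and> card b = 3" if "b \<in> ?B" for b
      using that
    proof
      assume "b \<in> C"
      then consider x where "x < n" "b = {(x, 0), (x, 1), (x, 2)}"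
        | x i where "x < n" "i < 3" "b = {(k, 0), (n + x, i), (x, (i + 1) mod 3)}"
        by (auto simp: C_def)
      then show ?thesis by cases (auto simp: k_def)
    qed (use mixed_triplesD in blast)
    fix p q :: "nat \<times> nat" assume pq: "p \<in> ?P" "q \<in> ?P" "p \<noteq> q"
    show "\<exists>b\<in>?B. p \<in> b \<and> q \<in> b"
    proof (cases "p = (k, 0) \<or> q = (k, 0)")
      case True
      then show ?thesis
        using inf_cover[of "fst p" "snd p"] inf_cover[of "fst q" "snd q"] pq by auto
    next
      case False
      then show ?thesis
        using mixed_triples_cover[of "fst p" "fst q" "snd p" "snd q" C] diag pq by auto
    qed
  next
    have "card C \<le> n + n * 3"
      unfolding C_def
      using card_image_le[of "{..<n}" "\<lambda>x. {(x, 0 :: nat), (x, 1), (x, 2)}"]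
        card_image_le[of "{..<n} \<times> {..<3 :: nat}" "\<lambda>(x, i). {(k, 0), (n + x, i), (x, (i + 1) mod 3)}"]
      by (intro order_trans[OF card_Un_le] add_mono) auto
    then have "card ?B \<le> card (mixed_triples k f) + 4 * n"
      using card_Un_le[of "mixed_triples k f" C] by linarith
    then have "6 * card ?B \<le> 9 * (k * (k - 1)) + 24 * n"
      using card_mixed_triples[of k f] by linarith
    also have "\<dots> = (6 * n + 1) * (6 * n + 1 - 1)"
      \<comment> \<open>For \<open>n = 0\<close> the subtraction in \<open>k - 1\<close> is
        truncated, hence the case distinction.\<close>
      by (cases n) (auto simp: k_def algebra_simps)
    finally show "6 * card ?B \<le> (6 * n + 1) * (6 * n + 1 - 1)" .
  qed
  then show ?thesis by blast
qed

lemma steiner_triple_system_exists: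
  assumes "v mod 6 = 1 \<or> v mod 6 = 3"
  shows "\<exists>(P :: (nat \<times> nat) set) B. steiner_triple_system v P B"
proof -
  have "v = 6 * (v div 6) + 1 \<or> v = 6 * (v div 6) + 3" using assms by presburger
  then show ?thesis using bose[of "v div 6"] skolem[of "v div 6"] by metis
qed

section \<open>Incidence graphs\<close>

lemma (in wf_digraph) cycle_app_isoI:
  assumes "cycle p" and hom: "digraph_isomorphism hom"
  shows "pre_digraph.cycle (app_iso hom G) (map (iso_arcs hom) p)"
proof -
  obtain u where u: "awalk u p u" "distinct (tl (awalk_verts u p))" "p \<noteq> []"
    using assms by (auto simp: cycle_def)
  have "set (tl (awalk_verts u p)) \<subseteq> verts G"
    using u(1) by (metis awalk_conv list.set_sel(2) subset_iff awalk_verts_non_Nil)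
  \<comment> \<open>Injectivity on these vertices keeps the vertex sequence of the image walk
    distinct.\<close>
  then have "inj_on (iso_verts hom) (set (tl (awalk_verts u p)))"
    using digraph_isomorphism_inj_on_verts[OF hom] inj_on_subset by blast
  then show ?thesis
    using u awalk_app_isoI[OF u(1) hom] awalk_verts_app_iso_eq[OF hom u(1)]
    unfolding pre_digraph.cycle_def by (auto simp: distinct_map map_tl[symmetric])
qed

text \<open>The arcs of a pair digraph are vertex pairs, so the vertex map alone determines the arcs
  of \<open>H\<close>. This lets later proofs work with a plain function.\<close>

lemma digraph_iso_verts_arcs:
  assumes "digraph_iso (with_proj G) (with_proj H)"
  obtains f where "inj_on f (pverts G)" "pverts H = f ` pverts G" "parcs H = map_prod f f ` parcs G"
    "\<And>u. u \<in> pverts G \<Longrightarrow> out_degree (with_proj H) (f u) = out_degree (with_proj G) u"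
proof -
  obtain hom where hom: "pre_digraph.digraph_isomorphism (with_proj G) hom"
    and H: "with_proj H = app_iso hom (with_proj G)"
    using assms by (auto simp: digraph_iso_def)
  then interpret wf_digraph "with_proj G" by (simp add: pre_digraph.digraph_isomorphism_def)
  have "pverts H = iso_verts hom ` pverts G"
    using arg_cong[OF H, of verts] by simp
  moreover have "parcs H = map_prod (iso_verts hom) (iso_verts hom) ` parcs G"
    using arg_cong[OF H, of arcs_ends] arcs_ends_app_iso_eq[OF hom] by (simp add: map_prod_def)
  ultimately show thesis
    using that[of "iso_verts hom"] digraph_isomorphism_inj_on_verts[OF hom]
      out_degree_app_iso_eq[OF hom] H by simp
qed

lemma digraph_iso_verts_arcsI:
  assumes "wf_digraph (with_proj G)" and f: "inj_on f (pverts G)"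
    and "pverts H = f ` pverts G" "parcs H = map_prod f f ` parcs G"
  shows "digraph_iso (with_proj G) (with_proj H)"
proof -
  interpret wf_digraph "with_proj G" by fact
  define hom where "hom = \<lparr>iso_verts = f, iso_arcs = map_prod f f, iso_head = snd, iso_tail = fst\<rparr>"
  have "parcs G \<subseteq> pverts G \<times> pverts G" using tail_in_verts head_in_verts by fastforce
  then have "inj_on (map_prod f f) (parcs G)"
    using map_prod_inj_on[OF f f] inj_on_subset by blast
  then have "pre_digraph.digraph_isomorphism (with_proj G) hom"
    using assms by (simp add: pre_digraph.digraph_isomorphism_def hom_def)
  moreover have "with_proj H = app_iso hom (with_proj G)"
    using assms by (simp add: app_iso_def hom_def with_proj_def)
  ultimately show ?thesis unfolding digraph_iso_def by blast
qed

text \<open>Every cycle of \<open>G\<close> has an image of the same length in \<open>H\<close>.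
  Applied to the inverse isomorphism as well, this gives equality.\<close>

lemma girth_digraph_iso_le:
  assumes "digraph_iso (with_proj G) (with_proj H)"
  shows "girth H \<le> girth G"
proof -
  obtain hom where hom: "pre_digraph.digraph_isomorphism (with_proj G) hom"
    and H: "with_proj H = app_iso hom (with_proj G)"
    using assms by (auto simp: digraph_iso_def)
  then interpret wf_digraph "with_proj G" by (simp add: pre_digraph.digraph_isomorphism_def)
  show ?thesis
    unfolding girth_def
  proof (rule INF_mono)
    fix p assume "p \<in> {p. cycle p \<and> 3 \<le> length p}"
    then show "\<exists>q\<in>{q. pre_digraph.cycle (with_proj H) q \<and> 3 \<le> length q}. enat (length q) \<le> enat (length p)"
      using cycle_app_isoI[OF _ hom, of p] H by (intro bexI[of _ "map (iso_arcs hom) p"]) auto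
  qed
qed

lemma pair_graph_digraph_iso:
  assumes G: "pair_graph G" and iso: "digraph_iso (with_proj G) (with_proj H)"
  shows "pair_graph H"
proof -
  interpret pair_graph G by fact
  obtain f where f: "inj_on f (pverts G)" "pverts H = f ` pverts G" "parcs H = map_prod f f ` parcs G"
    using digraph_iso_verts_arcs[OF iso] by metis
  have sym: "sym (parcs G)" using pair_sym_arcs by (simp add: symmetric_def)
  show ?thesis
  proof
    show "finite (pverts H)" "finite (parcs H)"
      using f pair_finite_verts pair_finite_arcs by auto
    show "fst e \<in> pverts H" "snd e \<in> pverts H" if "e \<in> parcs H" for e
      using that f arc_fst_in_verts arc_snd_in_verts by force+
    show "fst e \<noteq> snd e" if e: "e \<in> parcs H" for e
    proof -
      obtain x y where "(x, y) \<in> parcs G" "e = (f x, f y)" using e f by auto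
      then show ?thesis using pair_no_loops wellformed'[of x y] inj_onD[OF f(1), of x y] by auto
    qed
    have "sym (parcs H)"
      using sym unfolding f sym_def by force
    then show "symmetric (with_proj H)" by (simp add: symmetric_def)
  qed
qed

lemma bipartite_biregular_digraph_iso:
  assumes G: "bipartite_biregular n m g G" and iso: "digraph_iso (with_proj G) (with_proj H)"
  shows "bipartite_biregular n m g H" "card (pverts H) = card (pverts G)"
proof -
  obtain f where f: "inj_on f (pverts G)" "pverts H = f ` pverts G" "parcs H = map_prod f f ` parcs G"
    and deg: "\<And>u. u \<in> pverts G \<Longrightarrow> out_degree (with_proj H) (f u) = out_degree (with_proj G) u"
    using digraph_iso_verts_arcs[OF iso] by metis
  have graph: "pair_graph G" using G by (simp add: bipartite_biregular_def)
  then interpret pair_graph G .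
  have "digraph_iso (with_proj H) (with_proj G)"
    by (rule digraph_iso_swap[OF wf_digraph iso])
  then have girth: "girth H = enat g"
    using girth_digraph_iso_le[OF iso] girth_digraph_iso_le[of H G] G
    by (simp add: bipartite_biregular_def)
  obtain U W where UW: "pverts G = U \<union> W" "U \<inter> W = {}" "parcs G \<subseteq> U \<times> W \<union> W \<times> U"
    "\<forall>u \<in> U. out_degree (with_proj G) u = n" "\<forall>w \<in> W. out_degree (with_proj G) w = m"
    using G unfolding bipartite_biregular_def by blast
  have "f ` U \<inter> f ` W = {}" using f(1) UW(1,2) by (metis inj_on_image_Int image_empty Un_upper1 Un_upper2)
  moreover have "parcs H \<subseteq> f ` U \<times> f ` W \<union> f ` W \<times> f ` U"
    using UW(3) f(3) by auto
  ultimately show "bipartite_biregular n m g H"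
    unfolding bipartite_biregular_def
    using pair_graph_digraph_iso[OF graph iso] girth UW f(2) deg
    by (intro conjI exI[of _ "f ` U"] exI[of _ "f ` W"]) auto
  show "card (pverts H) = card (pverts G)" using f card_image by metis
qed

section \<open>Girth and degrees of incidence graphs\<close>

lemma girth_le:
  assumes "pre_digraph.cycle (with_proj G) p" "3 \<le> length p"
  shows "girth G \<le> enat (length p)"
  unfolding girth_def using assms by (intro INF_lower) simp

lemma out_degree_eq_card_neighbours:
  "out_degree (with_proj G) u = card {v. (u, v) \<in> parcs G}"
proof -
  have "out_arcs (with_proj G) u = Pair u ` {v. (u, v) \<in> parcs G}"
    by (auto simp: out_arcs_def)
  then show ?thesis by (simp add: out_degree_def card_image inj_on_def)
qed

lemma parcs_incidence_graph [simp]: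
  "(Inl x, Inr b) \<in> parcs (incidence_graph P B) \<longleftrightarrow> x \<in> P \<and> b \<in> B \<and> x \<in> b"
  "(Inr b, Inl x) \<in> parcs (incidence_graph P B) \<longleftrightarrow> x \<in> P \<and> b \<in> B \<and> x \<in> b"
  "(Inl x, Inl y) \<notin> parcs (incidence_graph P B)"
  "(Inr b, Inr c) \<notin> parcs (incidence_graph P B)"
  by (auto simp: incidence_graph_def)

lemma pverts_incidence_graph [simp]: "pverts (incidence_graph P B) = Inl ` P \<union> Inr ` B"
  by (simp add: incidence_graph_def)

context triple_configuration
begin

lemma card_incidence_graph: "card (pverts (incidence_graph P B)) = card P + card B"
proof -
  have "card (Inl ` P \<union> Inr ` B :: ('p + 'p set) set) = card (Inl ` P :: ('p + 'p set) set) + card (Inr ` B :: ('p + 'p set) set)"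
    using finite_points finite_blocks by (intro card_Un_disjoint) auto
  then show ?thesis by (simp add: card_image)
qed

lemma pair_graph_incidence_graph: "pair_graph (incidence_graph P B)"
proof
  show "finite (pverts (incidence_graph P B))"
    using finite_points finite_blocks by simp
  have "parcs (incidence_graph P B) \<subseteq> (Inl ` P \<union> Inr ` B) \<times> (Inl ` P \<union> Inr ` B)"
    by (auto simp: incidence_graph_def)
  then show "finite (parcs (incidence_graph P B))"
    using finite_points finite_blocks by (meson finite_SigmaI finite_UnI finite_imageI finite_subset)
  show "symmetric (with_proj (incidence_graph P B))"
    by (auto simp: symmetric_def sym_def incidence_graph_def)
qed (auto simp: incidence_graph_def)

text \<open>Lengths 3 and 5 contradict bipartiteness. A cycle of length 4 would be two distinct
  triples sharing two points, against \<open>linear\<close>.\<close>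

lemma length_cycle_incidence_graph:
  assumes "pre_digraph.cycle (with_proj (incidence_graph P B)) p" "3 \<le> length p"
  shows "6 \<le> length p"
proof (rule ccontr)
  assume "\<not> 6 \<le> length p"
  then consider "length p = 3" | "length p = 4" | "length p = 5" using assms(2) by linarith
  moreover obtain u where u: "u \<in> pverts (incidence_graph P B)" "set p \<subseteq> parcs (incidence_graph P B)"
      "pcas u p u" "distinct (tl (pawalk_verts u p))"
    using assms(1)
    by (auto simp: pre_digraph.cycle_def pre_digraph.awalk_def cas_with_proj_eq awalk_verts_with_proj_eq)
  ultimately show False
  proof cases
    case 1
    then obtain v0 v1 v2 where "p = [(v0, v1), (v1, v2), (v2, v0)]"
      using u(3) by (auto simp: numeral_eq_Suc length_Suc_conv)
    then show False using u(2) by (cases v0; cases v1; cases v2) auto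
  next
    case 2
    then obtain v0 v1 v2 v3 where p: "p = [(v0, v1), (v1, v2), (v2, v3), (v3, v0)]"
      using u(3) by (auto simp: numeral_eq_Suc length_Suc_conv)
    then have "v0 \<noteq> v2" "v1 \<noteq> v3" using u(4) by auto
    then show False using p u(2) linear
      by (cases v0; cases v1; cases v2; cases v3) (simp_all, blast+)
  next
    case 3
    then obtain v0 v1 v2 v3 v4 where "p = [(v0, v1), (v1, v2), (v2, v3), (v3, v4), (v4, v0)]"
      using u(3) by (auto simp: numeral_eq_Suc length_Suc_conv)
    then show False using u(2) by (cases v0; cases v1; cases v2; cases v3; cases v4) auto
  qed
qed

text \<open>A triangle of points and triples is a hexagon in the incidence graph; the hypotheses are
  those of \<open>triangle\<close>.\<close>

lemma girth_incidence_graph: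
  assumes "P \<noteq> {}" "2 \<le> m" "card P \<le> 2 * m + 2"
  shows "girth (incidence_graph P B) = enat 6"
proof (rule antisym)
  obtain x y z b c d where t: "b \<in> B" "c \<in> B" "d \<in> B" "x \<in> b" "y \<in> b" "y \<in> c" "z \<in> c" "z \<in> d" "x \<in> d"
    "x \<noteq> y" "y \<noteq> z" "x \<noteq> z" "b \<noteq> c" "c \<noteq> d" "b \<noteq> d"
    using triangle[OF assms] .
  then have P: "x \<in> P" "y \<in> P" "z \<in> P" using block_subset by auto
  let ?p = "[(Inl x, Inr b), (Inr b, Inl y), (Inl y, Inr c), (Inr c, Inl z), (Inl z, Inr d), (Inr d, Inl x)]"
  have "pre_digraph.cycle (with_proj (incidence_graph P B)) ?p"
    using t P
    by (auto simp: pre_digraph.cycle_def pre_digraph.awalk_def cas_with_proj_eq awalk_verts_with_proj_eq)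
  from girth_le[OF this] show "girth (incidence_graph P B) \<le> enat 6" by (simp add: numeral_eq_Suc)
  show "enat 6 \<le> girth (incidence_graph P B)"
    unfolding girth_def using length_cycle_incidence_graph by (intro INF_greatest) auto
qed

lemma bipartite_biregular_incidence_graph:
  assumes "P \<noteq> {}" "2 \<le> m" "card P \<le> 2 * m + 2"
  shows "bipartite_biregular 3 m 6 (incidence_graph P B)"
  unfolding bipartite_biregular_def
proof (intro conjI exI ballI)
  show "pair_graph (incidence_graph P B)" by (rule pair_graph_incidence_graph)
  show "girth (incidence_graph P B) = enat 6" using assms by (rule girth_incidence_graph)
  \<comment> \<open>This fixes the witnesses: the triples form the side of degree 3 and the points
    the side of degree \<open>m\<close>.\<close>
  show "pverts (incidence_graph P B) = Inr ` B \<union> Inl ` P" by auto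
  show "parcs (incidence_graph P B) \<subseteq> Inr ` B \<times> Inl ` P \<union> Inl ` P \<times> Inr ` B"
    by (auto simp: incidence_graph_def)
  show "out_degree (with_proj (incidence_graph P B)) v = 3" if v: "v \<in> Inr ` B" for v
  proof -
    obtain b where b: "b \<in> B" "v = Inr b" using v by blast
    then have "{w. (v, w) \<in> parcs (incidence_graph P B)} = Inl ` b"
      using block_subset by (auto simp: incidence_graph_def)
    then show ?thesis using card_block b by (simp add: out_degree_eq_card_neighbours card_image)
  qed
  show "out_degree (with_proj (incidence_graph P B)) v = m" if v: "v \<in> Inl ` P" for v
  proof -
    obtain x where x: "x \<in> P" "v = Inl x" using v by blast
    then have "{w. (v, w) \<in> parcs (incidence_graph P B)} = Inr ` {b \<in> B. x \<in> b}"
      by (auto simp: incidence_graph_def)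
    then show ?thesis using degree x by (simp add: out_degree_eq_card_neighbours card_image)
  qed
qed auto

end

lemma incidence_graph_image_iso:
  assumes "triple_configuration m P B" and f: "inj_on f P"
  shows "digraph_iso (with_proj (incidence_graph P B)) (with_proj (incidence_graph (f ` P) ((`) f ` B)))"
proof -
  interpret triple_configuration m P B by fact
  interpret pair_graph "incidence_graph P B" by (rule pair_graph_incidence_graph)
  have mem: "f x \<in> f ` b \<longleftrightarrow> x \<in> b" if "x \<in> P" "b \<in> B" for x b
    using that f block_subset by (meson inj_on_image_mem_iff)
  show ?thesis
  proof (rule digraph_iso_verts_arcsI)
    show "wf_digraph (with_proj (incidence_graph P B))" by (rule wf_digraph)
    have inj_B: "inj_on ((`) f) B" using inj_on_image_Pow[OF f] block_subset inj_on_subset by blast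
    show "inj_on (map_sum f ((`) f)) (pverts (incidence_graph P B))"
      by (intro inj_onI) (auto simp: inj_on_eq_iff[OF f] inj_on_eq_iff[OF inj_B])
    show "pverts (incidence_graph (f ` P) ((`) f ` B)) = map_sum f ((`) f) ` pverts (incidence_graph P B)"
      by (auto simp: image_Un image_image)
    show "parcs (incidence_graph (f ` P) ((`) f ` B)) =
        map_prod (map_sum f ((`) f)) (map_sum f ((`) f)) ` parcs (incidence_graph P B)"
      (is "?L = ?R")
    proof
      show "?L \<subseteq> ?R"
      proof
        fix e assume "e \<in> ?L"
        then obtain x b where "x \<in> P" "b \<in> B" "f x \<in> f ` b"
          "e = (Inl (f x), Inr (f ` b)) \<or> e = (Inr (f ` b), Inl (f x))"
          by (auto simp: incidence_graph_def)
        then have "(Inl x, Inr b) \<in> parcs (incidence_graph P B)" "(Inr b, Inl x) \<in> parcs (incidence_graph P B)"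
          "e = map_prod (map_sum f ((`) f)) (map_sum f ((`) f)) (Inl x, Inr b) \<or>
           e = map_prod (map_sum f ((`) f)) (map_sum f ((`) f)) (Inr b, Inl x)"
          using mem by simp_all
        then show "e \<in> ?R" by blast
      qed
      show "?R \<subseteq> ?L" by (auto simp: incidence_graph_def)
    qed
  qed
qed

text \<open>A vertex of degree 3 is replaced by its neighbourhood. In the absence of 4-cycles,
  distinct vertices have distinct neighbourhoods, so the set of triples loses no vertex.\<close>

lemma bipartite_biregular_configuration:
  fixes G :: "'a pair_pre_digraph"
  assumes G: "bipartite_biregular 3 m 6 G"
  obtains P :: "'a set" and B where "triple_configuration m P B" "P \<noteq> {}"
    "digraph_iso (with_proj G) (with_proj (incidence_graph P B))"
proof -
  obtain U W where UW: "pverts G = U \<union> W" "U \<inter> W = {}" "parcs G \<subseteq> U \<times> W \<union> W \<times> U"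
    "\<And>u. u \<in> U \<Longrightarrow> out_degree (with_proj G) u = 3" "\<And>w. w \<in> W \<Longrightarrow> out_degree (with_proj G) w = m"
    and graph: "pair_graph G" and girth: "girth G = enat 6"
    using G unfolding bipartite_biregular_def by blast
  interpret pair_graph G by fact
  have sym: "(v, u) \<in> parcs G \<longleftrightarrow> (u, v) \<in> parcs G" for u v
    using pair_sym_arcs by (auto simp: symmetric_def sym_def)
  define N where "N u = {w. (u, w) \<in> parcs G}" for u
  have NU: "N u \<subseteq> W" "card (N u) = 3" if "u \<in> U" for u
    using UW that by (auto simp: N_def out_degree_eq_card_neighbours)
  have common: "u = v" if "u \<in> U" "v \<in> U" "x \<in> N u" "y \<in> N u" "x \<in> N v" "y \<in> N v" "x \<noteq> y" for u v x y
  proof (rule ccontr)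
    assume "u \<noteq> v"
    \<comment> \<open>Two common neighbours of distinct \<open>u\<close> and \<open>v\<close> close
      a 4-cycle, below the girth.\<close>
    let ?p = "[(x, u), (u, y), (y, v), (v, x)]"
    have "x \<in> W" "y \<in> W" using that NU by auto
    then have "cycle ?p"
      using that UW(1,2) sym \<open>u \<noteq> v\<close>
      by (auto simp: cycle_def awalk_def N_def)
    from girth_le[OF this] show False using girth by simp
  qed
  have inj: "inj_on N U"
  proof (rule inj_onI)
    fix u v assume uv: "u \<in> U" "v \<in> U" "N u = N v"
    \<comment> \<open>Equal neighbourhoods share two points, so \<open>common\<close> identifies
      their vertices.\<close>
    obtain T where "T \<subseteq> N u" "card T = 2" using obtain_subset_with_card_n[of 2 "N u"] NU(2)[OF uv(1)] by auto
    then obtain x y where xy: "x \<in> N u" "y \<in> N u" "x \<noteq> y" by (auto simp: card_2_iff)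
    then show "u = v" using common[of u v x y] uv by simp
  qed
  have conf: "triple_configuration m W (N ` U)"
  proof
    show "finite W" using UW pair_finite_verts by simp
    show "b = c" if bc: "b \<in> N ` U" "c \<in> N ` U" and xy: "x \<in> b" "x \<in> c" "y \<in> b" "y \<in> c" "x \<noteq> y" for b c x y
    proof -
      obtain u v where "u \<in> U" "v \<in> U" "b = N u" "c = N v" using bc by blast
      then show ?thesis using common[of u v x y] xy by simp
    qed
    fix w assume w: "w \<in> W"
    then have "{v. (w, v) \<in> parcs G} = {u \<in> U. w \<in> N u}"
      using UW sym by (auto simp: N_def)
    moreover have "{b \<in> N ` U. w \<in> b} = N ` {u \<in> U. w \<in> N u}" by blast
    moreover have "inj_on N {u \<in> U. w \<in> N u}" using inj by (rule inj_on_subset) blast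
    ultimately show "card {b \<in> N ` U. w \<in> b} = m"
      using UW(5)[OF w] by (simp add: out_degree_eq_card_neighbours card_image)
  qed (use NU in auto)
  \<comment> \<open>Without points there are no arcs, and the girth would be infinite.\<close>
  have "W \<noteq> {}"
  proof
    assume "W = {}"
    then have "parcs G = {}" using UW by auto
    then have "{p. cycle p \<and> 3 \<le> length p} = {}" by (auto simp: cycle_def awalk_def)
    then have "girth G = \<infinity>" unfolding girth_def by (simp only: image_empty Inf_empty top_enat_def)
    then show False using girth by simp
  qed
  define f where "f v = (if v \<in> U then Inr (N v) else Inl v)" for v
  have "digraph_iso (with_proj G) (with_proj (incidence_graph W (N ` U)))"
  proof (rule digraph_iso_verts_arcsI)
    show "wf_digraph (with_proj G)" by (rule wf_digraph)
    show "inj_on f (pverts G)"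
      using inj by (auto simp: inj_on_def f_def)
    have fU: "f u = Inr (N u)" if "u \<in> U" for u using that by (simp add: f_def)
    have fW: "f w = Inl w" if "w \<in> W" for w using that UW by (auto simp: f_def)
    have "f ` U = Inr ` N ` U" "f ` W = Inl ` W" using fU fW by (auto simp: image_image)
    then show "pverts (incidence_graph W (N ` U)) = f ` pverts G"
      using UW by (auto simp: image_Un)
    have "parcs G = {(w, u) | w u. w \<in> W \<and> u \<in> U \<and> w \<in> N u} \<union> {(u, w) | w u. w \<in> W \<and> u \<in> U \<and> w \<in> N u}"
      using UW sym by (auto simp: N_def)
    then have "map_prod f f ` parcs G =
        {(f w, f u) | w u. w \<in> W \<and> u \<in> U \<and> w \<in> N u} \<union> {(f u, f w) | w u. w \<in> W \<and> u \<in> U \<and> w \<in> N u}"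
      by (auto simp: image_Un)
    also have "\<dots> = parcs (incidence_graph W (N ` U))"
      using fU fW by (auto simp: incidence_graph_def)
    finally show "parcs (incidence_graph W (N ` U)) = map_prod f f ` parcs G" by simp
  qed
  then show thesis using that conf \<open>W \<noteq> {}\<close> by blast
qed

section \<open>Cages\<close>

lemma triple_configuration_to_nat:
  assumes "triple_configuration m P B"
  obtains Q :: "nat set" and C where "triple_configuration m Q C" "card Q = card P"
    "digraph_iso (with_proj (incidence_graph P B)) (with_proj (incidence_graph Q C))"
proof -
  have "finite P" using assms by (rule triple_configuration.finite_points)
  then obtain f :: "'a \<Rightarrow> nat" where f: "inj_on f P" using finite_imp_inj_to_nat_seg by metis
  show thesis
    using that[OF triple_configuration_image[OF assms f]] incidence_graph_image_iso[OF assms f]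
    by (simp add: card_image f)
qed

text \<open>The least number of points of a nonempty configuration of degree \<open>m\<close>, as
  the next two lemmas establish together with \<open>card_points_ge\<close> and
  \<open>card_flags\<close>.\<close>

definition optimal_points :: "nat \<Rightarrow> nat" where
  "optimal_points m = (if m mod 3 = 2 then 2 * m + 2 else 2 * m + 1)"

text \<open>For \<open>m mod 3 = 2\<close> the product of \<open>m\<close> and
  \<open>2 * m + 1\<close> is 1 modulo 3, so \<open>v\<close> must exceed
  \<open>2 * m + 1\<close>.\<close>

lemma optimal_points_le:
  assumes "3 dvd m * v" "2 * m + 1 \<le> v"
  shows "optimal_points m \<le> v"
proof (cases "m mod 3 = 2 \<and> v = 2 * m + 1")
  case True
  then obtain k where "m = 3 * k + 2" by (metis mult_div_mod_eq)
  then have "m * v = 3 * (k * (6 * k + 5) + 4 * k + 3) + 1" using True by (simp add: algebra_simps)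
  then show ?thesis using assms(1) by presburger
qed (use assms in \<open>auto simp: optimal_points_def\<close>)

text \<open>If \<open>m mod 3\<close> is 0 or 1, then \<open>2 * m + 1\<close> is 1 or 3 modulo 6
  and a Steiner triple system does. Otherwise \<open>2 * m + 3\<close> is 1 modulo 6, and removing a
  point leaves \<open>2 * m + 2\<close>.\<close>

lemma optimal_configuration:
  obtains P :: "nat set" and B where "triple_configuration m P B" "card P = optimal_points m"
proof -
  have "\<exists>(P :: (nat \<times> nat) set) B. triple_configuration m P B \<and> card P = optimal_points m"
  proof (cases "m mod 3 = 2")
    case False
    then have "(2 * m + 1) mod 6 = 1 \<or> (2 * m + 1) mod 6 = 3" by presburger
    then obtain P :: "(nat \<times> nat) set" and B where S: "steiner_triple_system (2 * m + 1) P B"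
      using steiner_triple_system_exists by blast
    then have "card P = optimal_points m"
      using False by (simp add: steiner_triple_system_def optimal_points_def)
    then show ?thesis using steiner_triple_system_configuration[OF S] by blast
  next
    case True
    then have "(2 * m + 3) mod 6 = 1" by presburger
    then obtain P :: "(nat \<times> nat) set" and B where S: "steiner_triple_system (2 * m + 3) P B"
      using steiner_triple_system_exists by blast
    then have P: "finite P" "card P = 2 * m + 3" by (auto simp: steiner_triple_system_def)
    then obtain q where q: "q \<in> P" by (metis card.empty add_is_0 ex_in_conv zero_neq_numeral)
    then have "card (P - {q}) = optimal_points m" using P True by (simp add: optimal_points_def)
    then show ?thesis using steiner_triple_system_punctured[OF S q] by blast
  qed
  then show thesis using that triple_configuration_to_nat by metis
qed

text \<open>The order is thus an increasing function of the number of points, so minimising one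
  minimises the other.\<close>

lemma (in triple_configuration) order_incidence_graph:
  "3 * card (pverts (incidence_graph P B)) = (m + 3) * card P"
  using card_incidence_graph card_flags by (simp add: algebra_simps)

lemma bipartite_biregular_order_ge:
  fixes G :: "'a pair_pre_digraph"
  assumes G: "bipartite_biregular 3 m 6 G"
  shows "(m + 3) * optimal_points m \<le> 3 * card (pverts G)"
proof -
  obtain P :: "'a set" and B where P: "triple_configuration m P B" "P \<noteq> {}"
    and iso: "digraph_iso (with_proj G) (with_proj (incidence_graph P B))"
    using bipartite_biregular_configuration[OF G] .
  interpret triple_configuration m P B by fact
  have "optimal_points m \<le> card P"
    using optimal_points_le[of m "card P"] card_points_ge P card_flags by (metis dvd_triv_left ex_in_conv)
  then show ?thesis
    using bipartite_biregular_digraph_iso(2)[OF G iso] order_incidence_graph by simp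
qed

lemma optimal_bipartite_biregular:
  assumes "2 \<le> m"
  obtains H :: "nat pair_pre_digraph"
    where "bipartite_biregular 3 m 6 H" "3 * card (pverts H) = (m + 3) * optimal_points m"
proof -
  obtain P :: "nat set" and B where P: "triple_configuration m P B" "card P = optimal_points m"
    using optimal_configuration .
  interpret triple_configuration m P B by fact
  let ?I = "incidence_graph P B"
  interpret pair_graph ?I by (rule pair_graph_incidence_graph)
  have "card P \<le> 2 * m + 2" "P \<noteq> {}" using P by (auto simp: optimal_points_def split: if_splits)
  then have I: "bipartite_biregular 3 m 6 ?I"
    using bipartite_biregular_incidence_graph assms by simp
  \<comment> \<open>Cages compete with graphs on \<open>nat\<close>. The vertex type here is
    uncountable, but the finitely many vertices can be numbered.\<close>
  obtain f :: "nat + nat set \<Rightarrow> nat" where f: "inj_on f (pverts ?I)"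
    using finite_imp_inj_to_nat_seg[OF pair_finite_verts] by metis
  let ?H = "\<lparr>pverts = f ` pverts ?I, parcs = map_prod f f ` parcs ?I\<rparr>"
  have "digraph_iso (with_proj ?I) (with_proj ?H)"
    using wf_digraph f by (intro digraph_iso_verts_arcsI) auto
  from bipartite_biregular_digraph_iso[OF I this] show thesis
    using that order_incidence_graph P by metis
qed

text \<open>The lower bound holds over every vertex type and is attained over \<open>nat\<close>, so
  the cages are exactly the graphs attaining it.\<close>

lemma bipartite_biregular_cage_iff:
  fixes G :: "'a pair_pre_digraph"
  assumes "2 \<le> m"
  shows "bipartite_biregular_cage 3 m 6 G \<longleftrightarrow>
    bipartite_biregular 3 m 6 G \<and> 3 * card (pverts G) = (m + 3) * optimal_points m"
proof
  assume G: "bipartite_biregular_cage 3 m 6 G"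
  obtain H :: "nat pair_pre_digraph"
    where "bipartite_biregular 3 m 6 H" "3 * card (pverts H) = (m + 3) * optimal_points m"
    using optimal_bipartite_biregular[OF assms] .
  then show "bipartite_biregular 3 m 6 G \<and> 3 * card (pverts G) = (m + 3) * optimal_points m"
    using G bipartite_biregular_order_ge[of m G] by (fastforce simp: bipartite_biregular_cage_def)
next
  assume G: "bipartite_biregular 3 m 6 G \<and> 3 * card (pverts G) = (m + 3) * optimal_points m"
  have "card (pverts G) \<le> card (pverts H)"
    if "bipartite_biregular 3 m 6 H" for H :: "nat pair_pre_digraph"
    using bipartite_biregular_order_ge[OF that] G by linarith
  then show "bipartite_biregular_cage 3 m 6 G" using G by (simp add: bipartite_biregular_cage_def)
qed

lemma bipartite_biregular_cage_exists:
  assumes "2 \<le> m"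
  shows "\<exists>H :: nat pair_pre_digraph. bipartite_biregular_cage 3 m 6 H"
  using optimal_bipartite_biregular bipartite_biregular_cage_iff assms by metis

text \<open>The order of a cage forces exactly \<open>2 * m + 1\<close> points, and a configuration
  with that many points is a Steiner triple system. Conversely, the incidence graph of such a system
  attains the optimal order.\<close>

lemma bipartite_biregular_cage_iff_steiner:
  fixes G :: "'a pair_pre_digraph"
  assumes m: "2 \<le> m" "m mod 3 \<noteq> 2"
  shows "bipartite_biregular_cage 3 m 6 G \<longleftrightarrow>
    (\<exists>(P :: nat set) B. steiner_triple_system (2 * m + 1) P B \<and>
       digraph_iso (with_proj G) (with_proj (incidence_graph P B)))"
proof
  assume "bipartite_biregular_cage 3 m 6 G"
  then have G: "bipartite_biregular 3 m 6 G" "3 * card (pverts G) = (m + 3) * (2 * m + 1)"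
    using bipartite_biregular_cage_iff[of m G] m by (auto simp: optimal_points_def)
  obtain P :: "'a set" and B where P: "triple_configuration m P B"
    and iso: "digraph_iso (with_proj G) (with_proj (incidence_graph P B))"
    using bipartite_biregular_configuration[OF G(1)] by blast
  have "(m + 3) * card P = (m + 3) * (2 * m + 1)"
    using bipartite_biregular_digraph_iso(2)[OF G(1) iso] G(2)
      triple_configuration.order_incidence_graph[OF P] by simp
  then have "card P = 2 * m + 1" by (metis mult_left_cancel add_is_0 zero_neq_numeral)
  \<comment> \<open>The points found so far are vertices of \<open>G\<close>; they are renamed by
    natural numbers.\<close>
  moreover obtain Q :: "nat set" and C where Q: "triple_configuration m Q C" "card Q = card P"
    and "digraph_iso (with_proj (incidence_graph P B)) (with_proj (incidence_graph Q C))"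
    using triple_configuration_to_nat[OF P] .
  ultimately show "\<exists>(P :: nat set) B. steiner_triple_system (2 * m + 1) P B \<and>
      digraph_iso (with_proj G) (with_proj (incidence_graph P B))"
    using triple_configuration.steiner_triple_system[OF Q(1)] digraph_iso_trans[OF iso] by auto
next
  assume "\<exists>(P :: nat set) B. steiner_triple_system (2 * m + 1) P B \<and>
      digraph_iso (with_proj G) (with_proj (incidence_graph P B))"
  then obtain P :: "nat set" and B where S: "steiner_triple_system (2 * m + 1) P B"
    and iso: "digraph_iso (with_proj G) (with_proj (incidence_graph P B))" by blast
  interpret triple_configuration m P B by (rule steiner_triple_system_configuration[OF S])
  have P: "card P = 2 * m + 1" using S by (simp add: steiner_triple_system_def)
  then have "P \<noteq> {}" by auto
  then have I: "bipartite_biregular 3 m 6 (incidence_graph P B)"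
    using bipartite_biregular_incidence_graph m P by simp
  have "wf_digraph (with_proj G)"
    using iso by (auto simp: digraph_iso_def pre_digraph.digraph_isomorphism_def)
  from bipartite_biregular_digraph_iso[OF I digraph_iso_swap[OF this iso]]
  show "bipartite_biregular_cage 3 m 6 G"
    using bipartite_biregular_cage_iff[of m G] m order_incidence_graph P
    by (simp add: optimal_points_def)
qed

theorem theorem11:
  fixes m :: nat
  assumes "m > 3"
  shows "(m mod 3 = 0 \<or> m mod 3 = 1 \<longrightarrow>
            (\<exists>H :: nat pair_pre_digraph. bipartite_biregular_cage 3 m 6 H) \<and>
            (\<forall>G :: 'a pair_pre_digraph.
               (bipartite_biregular_cage 3 m 6 G \<longleftrightarrow>
                  (\<exists>(P :: nat set) B. steiner_triple_system (2 * m + 1) P B \<and>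
                     digraph_iso (with_proj G) (with_proj (incidence_graph P B)))) \<and>
               (bipartite_biregular_cage 3 m 6 G \<longrightarrow> int (card (pverts G)) = n0_3_6 m))) \<and>
         (m mod 3 = 2 \<longrightarrow>
            (\<exists>H :: nat pair_pre_digraph. bipartite_biregular_cage 3 m 6 H) \<and>
            (\<forall>G :: 'a pair_pre_digraph.
               bipartite_biregular_cage 3 m 6 G \<longrightarrow>
                 real (card (pverts G)) =
                   (2 * real m ^ 2 + 7 * real m + 3) / 3 + (real m + 3) / 3))"
proof -
  have m: "2 \<le> m" using assms by simp
  have order: "real (card (pverts G)) = (real m + 3) * real (optimal_points m) / 3"
    if "bipartite_biregular_cage 3 m 6 G" for G :: "'a pair_pre_digraph"
  proof -
    have "real (3 * card (pverts G)) = real ((m + 3) * optimal_points m)"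
      using that bipartite_biregular_cage_iff[OF m] by metis
    then show ?thesis by simp
  qed
  have "int (card (pverts G)) = n0_3_6 m"
    if "m mod 3 \<noteq> 2" "bipartite_biregular_cage 3 m 6 G" for G :: "'a pair_pre_digraph"
  proof -
    \<comment> \<open>\<open>2 * m ^ 2 + 7 * m + 3\<close> factors as
      \<open>(m + 3) * (2 * m + 1)\<close>, three times the order, so the ceiling is taken of an
      integer.\<close>
    have "(2 * real m ^ 2 + 7 * real m + 3) / 3 = real (card (pverts G))"
      using order[OF that(2)] that(1) by (simp add: optimal_points_def power2_eq_square algebra_simps)
    then show ?thesis unfolding n0_3_6_def by simp
  qed
  \<comment> \<open>The additional point, \<open>2 * m + 2\<close> instead of
    \<open>2 * m + 1\<close>, accounts for the extra summand \<open>(m + 3) / 3\<close>.\<close>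
  moreover have "real (card (pverts G)) = (2 * real m ^ 2 + 7 * real m + 3) / 3 + (real m + 3) / 3"
    if "m mod 3 = 2" "bipartite_biregular_cage 3 m 6 G" for G :: "'a pair_pre_digraph"
    using order[OF that(2)] that(1) by (simp add: optimal_points_def power2_eq_square field_simps)
  moreover have "m mod 3 = 0 \<or> m mod 3 = 1 \<longleftrightarrow> m mod 3 \<noteq> 2" by presburger
  ultimately show ?thesis
    using bipartite_biregular_cage_exists[OF m] bipartite_biregular_cage_iff_steiner[OF m]
    by (intro conjI impI allI) blast+
qed

end
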